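(* For every $\mathrm{BL}$ formula $A$: if $A$ is provable in $\mathrm{TBL}$, then $A$ is valid in $\mathrm{BL}$.
   Context: $\mathrm{BL}$: formulae $A ::= p \mid \neg A \mid A\wedge A \mid \Box A \mid A \ast A \mid A \mathrel{-\!\!\ast} A$ over countably many letters. A $\mathrm{BL}$ model is $(W,\le,R,V)$ with $(W,\le)$ a rooted partial order with persistent separation (writing $w_1\bowtie w_2$ for "neither $w_1\le w_2$ nor $w_2\le w_1$": if $w_1\bowtie w_2$ and $w_1\le w_1'$ then $w_1'\bowtie w_2$), $R(w,w_1,w_2)$ iff $w\le w_1$, $w\le w_2$, $w_1\bowtie w_2$, and $V$ a valuation; satisfaction classical for $p,\neg,\wedge$; $w\Vdash\Box A$ iff $A$ holds at every $w'\ge w$; $w\Vdash A\ast B$ iff $\exists w_1,w_2$: $R(w,w_1,w_2)$, $w_1\Vdash A$, $w_2\Vdash B$; $w\Vdash A\mathrel{-\!\!\ast}B$ iff $\forall w_1,w_2$: if $R(w_2,w,w_1)$ and $w_1\Vdash A$ then $w_2\Vdash B$. $A$ is valid if it holds at every world of every $\mathrm{BL}$ model. $\mathrm{TBL}$: nodes are signed labelled formulae $\mathsf S A:x$ ($\mathsf S\in\{\mathsf T,\mathsf F\}$, $x$ from a countable set of labels) and signed constraints $\mathsf T\,x\le y$, $\mathsf F\,x\le y$; $\mathsf T\,x\bowtie y$ abbreviates $\mathsf F\,x\le y,\mathsf F\,y\le x$ and $\mathsf T\,R(x,y,z)$ abbreviates $\mathsf T\,x\le y,\mathsf T\,x\le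 z,\mathsf T\,y\bowtie z$. A tableau for $A:x$ is a finitely branching rooted tree with root $\mathsf F A:x$ built by rules that, when their premises occur on a branch, extend it by their conclusions (splitting on "$\mid$"); $u,v$ denote distinct fresh labels. Rules: $\mathsf F\neg A:x\Rightarrow\mathsf T A:x$; $\mathsf T\neg A:x\Rightarrow\mathsf F A:x$; $\mathsf T A\wedge B:x\Rightarrow\mathsf T A:x,\mathsf T B:x$; $\mathsf F A\wedge B:x\Rightarrow\mathsf F A:x\mid\mathsf F B:x$; $\mathsf F\Box A:x\Rightarrow\mathsf T\,x\le u,\mathsf F A:u$; $\mathsf T\Box A:x,\mathsf T\,x\le y\Rightarrow\mathsf T A:y$; $\mathsf T A\ast B:x\Rightarrow\mathsf T\,R(x,u,v),\mathsf T A:u,\mathsf T B:v$; $\mathsf F A\ast B:x,\mathsf T\,R(x,y,z)\Rightarrow\mathsf F A:y\mid\mathsf F B:z$; $\mathsf T A\mathrel{-\!\!\ast}B:x,\mathsf T\,R(z,x,y)\Rightarrow\mathsf F A:y\mid\mathsf T B:z$; $\mathsf F A\mathrel{-\!\!\ast}B:x\Rightarrow\mathsf T\,R(v,x,u),\mathsf T A:u,\mathsf F B:v$; $\mathsf S A:x,\mathsf T\,x\le y,\mathsf T\,y\le x\Rightarrow\mathsf S A:y$; $\mathsf S A:x,\mathsf S' B:y\Rightarrow\mathsf T\,x\le y\mid\mathsf T\,y\le x\mid\mathsf T\,x\bowtie y$; $\mathsf S A:x\Rightarrow\mathsf T\,x\le x$; $\mathsf T\,x\le y,\mathsf T\,y\le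 z\Rightarrow\mathsf T\,x\le z$; $\mathsf T\,x_1\bowtie x_2,\mathsf T\,x_i\le y\Rightarrow\mathsf T\,x_j\bowtie y$ ($i\in\{1,2\},j=3-i$). A branch is closed if it contains $\mathsf T A:x$ and $\mathsf F A:x$, or $\mathsf T\,x\le y$ and $\mathsf F\,x\le y$; a tableau is closed if all branches are closed. $A$ is provable in $\mathrm{TBL}$ if for some label $x$ there is a closed tableau for $A:x$. *)

theory Defs
  imports Main "HOL-Library.Sublist"
begin

section \<open>Syntax and semantics of BL\<close>

datatype fm =
    Atom nat
  | Neg fm
  | And fm fm
  | Box fm
  | Sep fm fm
  | Wand fm fm

record 'w bl_frame =
  worlds :: "'w set"
  le :: "('w \<times> 'w) set"
  rel :: "'w \<Rightarrow> 'w \<Rightarrow> 'w \<Rightarrow> bool"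

record 'w bl_model = "'w bl_frame" +
  val :: "nat \<Rightarrow> 'w set"

definition separated :: "('w, 'z) bl_frame_scheme \<Rightarrow> 'w \<Rightarrow> 'w \<Rightarrow> bool" where
  "separated M w1 w2 \<longleftrightarrow> (w1, w2) \<notin> le M \<and> (w2, w1) \<notin> le M"

definition is_bl_frame :: "('w, 'z) bl_frame_scheme \<Rightarrow> bool" where
  "is_bl_frame M \<longleftrightarrow>
     partial_order_on (worlds M) (le M) \<and>
     (\<exists>r\<in>worlds M. \<forall>w\<in>worlds M. (r, w) \<in> le M) \<and>
     (\<forall>w1\<in>worlds M. \<forall>w2\<in>worlds M. \<forall>w1'\<in>worlds M.
        separated M w1 w2 \<longrightarrow> (w1, w1') \<in> le M \<longrightarrow> separated M w1' w2) \<and>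
     (\<forall>w\<in>worlds M. \<forall>w1\<in>worlds M. \<forall>w2\<in>worlds M.
        rel M w w1 w2 \<longleftrightarrow> (w, w1) \<in> le M \<and> (w, w2) \<in> le M \<and> separated M w1 w2)"

definition is_bl_model :: "'w bl_model \<Rightarrow> bool" where
  "is_bl_model M \<longleftrightarrow> is_bl_frame M \<and> (\<forall>p. val M p \<subseteq> worlds M)"

primrec sat :: "'w bl_model \<Rightarrow> 'w \<Rightarrow> fm \<Rightarrow> bool" where
  "sat M w (Atom p) \<longleftrightarrow> w \<in> val M p"
| "sat M w (Neg A) \<longleftrightarrow> \<not> sat M w A"
| "sat M w (And A B) \<longleftrightarrow> sat M w A \<and> sat M w B"
| "sat M w (Box A) \<longleftrightarrow> (\<forall>w'\<in>worlds M. (w, w') \<in> le M \<longrightarrow> sat M w' A)"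
| "sat M w (Sep A B) \<longleftrightarrow>
     (\<exists>w1\<in>worlds M. \<exists>w2\<in>worlds M. rel M w w1 w2 \<and> sat M w1 A \<and> sat M w2 B)"
| "sat M w (Wand A B) \<longleftrightarrow>
     (\<forall>w1\<in>worlds M. \<forall>w2\<in>worlds M. rel M w2 w w1 \<and> sat M w1 A \<longrightarrow> sat M w2 B)"

text \<open>HOL cannot quantify over types inside a formula, so the type of worlds is an explicit
  argument. A theorem about this notion with \<open>'w\<close> free covers models over every type.\<close>

definition bl_valid :: "'w itself \<Rightarrow> fm \<Rightarrow> bool" where
  "bl_valid _ A \<longleftrightarrow> (\<forall>M :: 'w bl_model. is_bl_model M \<longrightarrow> (\<forall>w\<in>worlds M. sat M w A))"


section \<open>The tableau calculus TBL\<close>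

datatype sign = TT | FF

type_synonym label = nat

datatype node =
    Form sign fm label
  | LeC sign label label

primrec labels :: "node \<Rightarrow> label set" where
  "labels (Form S A x) = {x}"
| "labels (LeC S x y) = {x, y}"

definition fresh :: "label \<Rightarrow> node set \<Rightarrow> bool" where
  "fresh u \<Gamma> \<longleftrightarrow> u \<notin> \<Union> (labels ` \<Gamma>)"

abbreviation T_sep :: "label \<Rightarrow> label \<Rightarrow> node list" where
  "T_sep x y \<equiv> [LeC FF x y, LeC FF y x]"

abbreviation T_rel :: "label \<Rightarrow> label \<Rightarrow> label \<Rightarrow> node list" where
  "T_rel x y z \<equiv> [LeC TT x y, LeC TT x z] @ T_sep y z"

text \<open>\<open>tbl_rule \<Gamma> [\<delta>1, \<dots>, \<delta>n]\<close>: on a branch whose set of nodes is \<open>\<Gamma>\<close>, some rule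
  allows splitting into \<open>n\<close> branches, the \<open>i\<close>-th one extended by the nodes \<open>\<delta>i\<close>. Freshness
  of a label is relative to the branch being extended.\<close>

inductive tbl_rule :: "node set \<Rightarrow> node list list \<Rightarrow> bool" for \<Gamma> :: "node set" where
  F_Neg: "Form FF (Neg A) x \<in> \<Gamma> \<Longrightarrow> tbl_rule \<Gamma> [[Form TT A x]]"
| T_Neg: "Form TT (Neg A) x \<in> \<Gamma> \<Longrightarrow> tbl_rule \<Gamma> [[Form FF A x]]"
| T_And: "Form TT (And A B) x \<in> \<Gamma> \<Longrightarrow> tbl_rule \<Gamma> [[Form TT A x, Form TT B x]]"
| F_And: "Form FF (And A B) x \<in> \<Gamma> \<Longrightarrow> tbl_rule \<Gamma> [[Form FF A x], [Form FF B x]]"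
| F_Box: "Form FF (Box A) x \<in> \<Gamma> \<Longrightarrow> fresh u \<Gamma> \<Longrightarrow>
    tbl_rule \<Gamma> [[LeC TT x u, Form FF A u]]"
| T_Box: "Form TT (Box A) x \<in> \<Gamma> \<Longrightarrow> LeC TT x y \<in> \<Gamma> \<Longrightarrow> tbl_rule \<Gamma> [[Form TT A y]]"
| T_Sep: "Form TT (Sep A B) x \<in> \<Gamma> \<Longrightarrow> fresh u \<Gamma> \<Longrightarrow> fresh v \<Gamma> \<Longrightarrow> u \<noteq> v \<Longrightarrow>
    tbl_rule \<Gamma> [T_rel x u v @ [Form TT A u, Form TT B v]]"
| F_Sep: "Form FF (Sep A B) x \<in> \<Gamma> \<Longrightarrow> set (T_rel x y z) \<subseteq> \<Gamma> \<Longrightarrow>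
    tbl_rule \<Gamma> [[Form FF A y], [Form FF B z]]"
| T_Wand: "Form TT (Wand A B) x \<in> \<Gamma> \<Longrightarrow> set (T_rel z x y) \<subseteq> \<Gamma> \<Longrightarrow>
    tbl_rule \<Gamma> [[Form FF A y], [Form TT B z]]"
| F_Wand: "Form FF (Wand A B) x \<in> \<Gamma> \<Longrightarrow> fresh u \<Gamma> \<Longrightarrow> fresh v \<Gamma> \<Longrightarrow> u \<noteq> v \<Longrightarrow>
    tbl_rule \<Gamma> [T_rel v x u @ [Form TT A u, Form FF B v]]"
| Antisym: "Form S A x \<in> \<Gamma> \<Longrightarrow> LeC TT x y \<in> \<Gamma> \<Longrightarrow> LeC TT y x \<in> \<Gamma> \<Longrightarrow>
    tbl_rule \<Gamma> [[Form S A y]]"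
| Compare: "Form S A x \<in> \<Gamma> \<Longrightarrow> Form S' B y \<in> \<Gamma> \<Longrightarrow>
    tbl_rule \<Gamma> [[LeC TT x y], [LeC TT y x], T_sep x y]"
| Refl: "Form S A x \<in> \<Gamma> \<Longrightarrow> tbl_rule \<Gamma> [[LeC TT x x]]"
| Trans: "LeC TT x y \<in> \<Gamma> \<Longrightarrow> LeC TT y z \<in> \<Gamma> \<Longrightarrow> tbl_rule \<Gamma> [[LeC TT x z]]"
| Persist1: "set (T_sep x1 x2) \<subseteq> \<Gamma> \<Longrightarrow> LeC TT x1 y \<in> \<Gamma> \<Longrightarrow> tbl_rule \<Gamma> [T_sep x2 y]"
| Persist2: "set (T_sep x1 x2) \<subseteq> \<Gamma> \<Longrightarrow> LeC TT x2 y \<in> \<Gamma> \<Longrightarrow> tbl_rule \<Gamma> [T_sep x1 y]"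

text \<open>Finitely branching trees of possibly infinite depth.\<close>

codatatype tree = Tree (root: node) (children: "tree list")

fun stem :: "node \<Rightarrow> node list \<Rightarrow> tree list \<Rightarrow> tree" where
  "stem n [] ts = Tree n ts"
| "stem n (m # ms) ts = Tree n [stem m ms ts]"

text \<open>\<open>grown \<Gamma> ts\<close>: the trees \<open>ts\<close> are what rule applications may attach below the last
  node of a branch whose set of nodes is \<open>\<Gamma>\<close>. Each application attaches one non-branching
  segment per alternative. The predicate is coinductive, so rules may be applied
  infinitely often.\<close>

coinductive grown :: "node set \<Rightarrow> tree list \<Rightarrow> bool" where
  stop: "grown \<Gamma> []"
| extend: "tbl_rule \<Gamma> \<delta>s \<Longrightarrow> length tss = length \<delta>s \<Longrightarrow>
    (\<forall>i<length \<delta>s. grown (\<Gamma> \<union> set (\<delta>s ! i)) (tss ! i)) \<Longrightarrow>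
    grown \<Gamma> (map2 (\<lambda>\<delta> ts. stem (hd \<delta>) (tl \<delta>) ts) \<delta>s tss)"

definition tableau_for :: "fm \<Rightarrow> label \<Rightarrow> tree \<Rightarrow> bool" where
  "tableau_for A x t \<longleftrightarrow> root t = Form FF A x \<and> grown {Form FF A x} (children t)"

text \<open>Positions in a tree are lists of child indices read from the root.\<close>

inductive_set positions :: "(tree \<times> nat list) set" where
  root: "(t, []) \<in> positions"
| child: "i < length (children t) \<Longrightarrow> (children t ! i, p) \<in> positions \<Longrightarrow>
    (t, i # p) \<in> positions"

primrec node_at :: "nat list \<Rightarrow> tree \<Rightarrow> node" where
  "node_at [] t = root t"
| "node_at (i # p) t = node_at p (children t ! i)"

text \<open>A branch is a maximal path from the root, finite or infinite, that is, a maximal chain of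
  positions with respect to the prefix order.\<close>

definition is_branch :: "tree \<Rightarrow> nat list set \<Rightarrow> bool" where
  "is_branch t P \<longleftrightarrow> pred_on.maxchain {p. (t, p) \<in> positions} strict_prefix P"

definition branch_nodes :: "tree \<Rightarrow> nat list set \<Rightarrow> node set" where
  "branch_nodes t P = (\<lambda>p. node_at p t) ` P"

definition closed_nodes :: "node set \<Rightarrow> bool" where
  "closed_nodes \<Gamma> \<longleftrightarrow>
     (\<exists>A x. Form TT A x \<in> \<Gamma> \<and> Form FF A x \<in> \<Gamma>) \<or>
     (\<exists>x y. LeC TT x y \<in> \<Gamma> \<and> LeC FF x y \<in> \<Gamma>)"

definition closed_tableau :: "tree \<Rightarrow> bool" where
  "closed_tableau t \<longleftrightarrow> (\<forall>P. is_branch t P \<longrightarrow> closed_nodes (branch_nodes t P))"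

definition tbl_provable :: "fm \<Rightarrow> bool" where
  "tbl_provable A \<longleftrightarrow> (\<exists>x t. tableau_for A x t \<and> closed_tableau t)"

end

theory Submission imports Defs begin

text \<open>
  If \<open>A\<close> fails at some world, the nodes of the root segment are satisfiable, and every rule sends
  a satisfiable branch to at least one satisfiable branch. Following such alternatives yields a
  maximal path, possibly infinite, all of whose finite initial parts are satisfiable. A clash
  involves only two nodes, which already lie in a common finite initial part, so this path is
  open; no assignment satisfying an entire infinite path is needed.
\<close>

section \<open>Satisfaction of nodes and soundness of the single rules\<close>

primrec sat_node :: "'w bl_model \<Rightarrow> (label \<Rightarrow> 'w) \<Rightarrow> node \<Rightarrow> bool" where
  "sat_node M f (Form S A x) \<longleftrightarrow> (sat M (f x) A \<longleftrightarrow> S = TT)"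
| "sat_node M f (LeC S x y) \<longleftrightarrow> ((f x, f y) \<in> le M \<longleftrightarrow> S = TT)"

text \<open>All labels, even those absent from \<Gamma>, must denote worlds, so quantifiers bounded
  by \<open>worlds M\<close> can be instantiated at \<open>f x\<close> without tracking which labels
  occur.\<close>

definition sat_nodes :: "'w bl_model \<Rightarrow> (label \<Rightarrow> 'w) \<Rightarrow> node set \<Rightarrow> bool" where
  "sat_nodes M f \<Gamma> \<longleftrightarrow> range f \<subseteq> worlds M \<and> (\<forall>n\<in>\<Gamma>. sat_node M f n)"

lemma sat_nodes_Un:
  "sat_nodes M f (\<Gamma> \<union> \<Delta>) \<longleftrightarrow> sat_nodes M f \<Gamma> \<and> (\<forall>n\<in>\<Delta>. sat_node M f n)"
  by (auto simp: sat_nodes_def)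

lemma sat_node_cong:
  "(\<And>x. x \<in> labels n \<Longrightarrow> f x = g x) \<Longrightarrow> sat_node M f n = sat_node M g n"
  by (cases n) auto

text \<open>The truth of a node depends only on the values of its own labels, so a fresh label is
  free to be sent to a witness.\<close>

lemma sat_nodes_fresh:
  assumes "sat_nodes M f \<Gamma>" "fresh u \<Gamma>" "w \<in> worlds M"
  shows "sat_nodes M (f(u := w)) \<Gamma>"
proof -
  have "sat_node M (f(u := w)) n = sat_node M f n" if "n \<in> \<Gamma>" for n
    using that assms(2) by (intro sat_node_cong) (auto simp: fresh_def)
  with assms(1,3) show ?thesis
    by (auto simp: sat_nodes_def)
qed

text \<open>Ensures that \<open>stem (hd \<delta>) (tl \<delta>)\<close> spells out exactly the
  nodes of \<delta>.\<close>

lemma tbl_rule_nonempty: "tbl_rule \<Gamma> \<delta>s \<Longrightarrow> \<delta> \<in> set \<delta>s \<Longrightarrow> \<delta> \<noteq> []"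
  by (induction rule: tbl_rule.induct) auto

lemma fresh_label_neq: "n \<in> \<Gamma> \<Longrightarrow> x \<in> labels n \<Longrightarrow> fresh u \<Gamma> \<Longrightarrow> u \<noteq> x"
  by (auto simp: fresh_def)

text \<open>For rules without fresh labels the given assignment already verifies one of the
  alternatives. For \<open>F_Box\<close>, \<open>T_Sep\<close> and \<open>F_Wand\<close> the fresh
  labels are sent to worlds that witness the truth or falsity of the premise.\<close>

lemma tbl_rule_sound:
  assumes rule: "tbl_rule \<Gamma> \<delta>s" and frame: "is_bl_frame M" and f: "sat_nodes M f \<Gamma>"
  shows "\<exists>g. \<exists>\<delta>\<in>set \<delta>s. sat_nodes M g (\<Gamma> \<union> set \<delta>)"
proof -
  have W [simp]: "f x \<in> worlds M" for x
    using f by (auto simp: sat_nodes_def)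
  have S: "n \<in> \<Gamma> \<Longrightarrow> sat_node M f n" for n
    using f by (auto simp: sat_nodes_def)
  have refl: "w \<in> worlds M \<Longrightarrow> (w, w) \<in> le M" for w
    using frame
    by (auto simp: is_bl_frame_def partial_order_on_def preorder_on_def refl_on_def)
  have trans: "(a, b) \<in> le M \<Longrightarrow> (b, c) \<in> le M \<Longrightarrow> (a, c) \<in> le M" for a b c
    using frame
    by (auto simp: is_bl_frame_def partial_order_on_def preorder_on_def dest: transD)
  have antisym: "(a, b) \<in> le M \<Longrightarrow> (b, a) \<in> le M \<Longrightarrow> a = b" for a b
    using frame by (auto simp: is_bl_frame_def partial_order_on_def dest: antisymD)
  have persist: "a \<in> worlds M \<Longrightarrow> b \<in> worlds M \<Longrightarrow> c \<in> worlds M \<Longrightarrow>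
      separated M a b \<Longrightarrow> (a, c) \<in> le M \<Longrightarrow> separated M c b" for a b c
    using frame unfolding is_bl_frame_def by blast
  have rel: "a \<in> worlds M \<Longrightarrow> b \<in> worlds M \<Longrightarrow> c \<in> worlds M \<Longrightarrow>
      rel M a b c \<longleftrightarrow> (a, b) \<in> le M \<and> (a, c) \<in> le M \<and> separated M b c" for a b c
    using frame unfolding is_bl_frame_def by blast
  \<comment> \<open>This settles every rule without fresh labels: one alternative that is true under
    the old assignment suffices.\<close>
  have same: ?thesis if "\<delta> \<in> set \<delta>s" "\<forall>n\<in>set \<delta>. sat_node M f n" for \<delta>
    using that f by (auto simp: sat_nodes_Un)
  show ?thesis using rule
  proof cases
    case (F_Neg A x)
    then show ?thesis using S[OF F_Neg(2)] by (intro same) auto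
  next
    case (T_Neg A x)
    then show ?thesis using S[OF T_Neg(2)] by (intro same) auto
  next
    case (T_And A B x)
    then show ?thesis using S[OF T_And(2)] by (intro same) auto
  next
    case (F_And A B x)
    then have "\<not> sat M (f x) A \<or> \<not> sat M (f x) B" using S[OF F_And(2)] by auto
    then show ?thesis using F_And(1) same by fastforce
  next
    case (F_Box A x u)
    obtain w where w: "w \<in> worlds M" "(f x, w) \<in> le M" "\<not> sat M w A"
      using S[OF F_Box(2)] by auto
    have "u \<noteq> x" using fresh_label_neq[OF F_Box(2) _ F_Box(3)] by simp
    moreover have "sat_nodes M (f(u := w)) \<Gamma>" using f F_Box(3) w(1) by (rule sat_nodes_fresh)
    ultimately have "sat_nodes M (f(u := w)) (\<Gamma> \<union> set [LeC TT x u, Form FF A u])"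
      using w by (simp add: sat_nodes_Un del: Un_insert_right)
    then show ?thesis using F_Box(1) by auto
  next
    case (T_Box A x y)
    then show ?thesis using S[OF T_Box(2)] S[OF T_Box(3)] by (intro same) auto
  next
    case (T_Sep A B x u v)
    obtain a b where w: "a \<in> worlds M" "b \<in> worlds M" "rel M (f x) a b" "sat M a A" "sat M b B"
      using S[OF T_Sep(2)] by auto
    have "u \<noteq> x" "v \<noteq> x"
      using fresh_label_neq[OF T_Sep(2) _ T_Sep(3)] fresh_label_neq[OF T_Sep(2) _ T_Sep(4)]
      by simp_all
    moreover have "sat_nodes M (f(u := a, v := b)) \<Gamma>"
      using f T_Sep(3,4) w(1,2) by (intro sat_nodes_fresh)
    ultimately have "sat_nodes M (f(u := a, v := b))
        (\<Gamma> \<union> set (T_rel x u v @ [Form TT A u, Form TT B v]))"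
      using w T_Sep(5)
      by (simp add: sat_nodes_Un rel separated_def del: Un_insert_right)
    then show ?thesis using T_Sep(1) by auto
  next
    case (F_Sep A B x y z)
    have "rel M (f x) (f y) (f z)"
      using F_Sep(3) by (auto simp: rel separated_def dest!: S)
    then have "\<not> sat M (f y) A \<or> \<not> sat M (f z) B" using S[OF F_Sep(2)] by auto
    then show ?thesis using F_Sep(1) same by fastforce
  next
    case (T_Wand A B x z y)
    have "rel M (f z) (f x) (f y)"
      using T_Wand(3) by (auto simp: rel separated_def dest!: S)
    then have "\<not> sat M (f y) A \<or> sat M (f z) B"
      using S[OF T_Wand(2)] W[of y] W[of z] by (simp, blast)
    then show ?thesis using T_Wand(1) same by fastforce
  next
    case (F_Wand A B x u v)
    obtain a b where w: "a \<in> worlds M" "b \<in> worlds M" "rel M b (f x) a" "sat M a A" "\<not> sat M b B"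
      using S[OF F_Wand(2)] by auto
    have "u \<noteq> x" "v \<noteq> x"
      using fresh_label_neq[OF F_Wand(2) _ F_Wand(3)] fresh_label_neq[OF F_Wand(2) _ F_Wand(4)]
      by simp_all
    moreover have "sat_nodes M (f(u := a, v := b)) \<Gamma>"
      using f F_Wand(3,4) w(1,2) by (intro sat_nodes_fresh)
    ultimately have "sat_nodes M (f(u := a, v := b))
        (\<Gamma> \<union> set (T_rel v x u @ [Form TT A u, Form FF B v]))"
      using w F_Wand(5)
      by (simp add: sat_nodes_Un rel separated_def del: Un_insert_right)
    then show ?thesis using F_Wand(1) by auto
  next
    case (Antisym s A x y)
    have "f x = f y" using S[OF Antisym(3)] S[OF Antisym(4)] by (auto intro: antisym)
    then show ?thesis using S[OF Antisym(2)] Antisym(1) by (intro same) auto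
  next
    case (Compare s A x s' B y)
    consider "(f x, f y) \<in> le M" | "(f y, f x) \<in> le M"
      | "(f x, f y) \<notin> le M" "(f y, f x) \<notin> le M" by blast
    then show ?thesis
    proof cases
      case 1 with Compare(1) show ?thesis by (intro same[of "[LeC TT x y]"]) auto
    next
      case 2 with Compare(1) show ?thesis by (intro same[of "[LeC TT y x]"]) auto
    next
      case 3 with Compare(1) show ?thesis by (intro same[of "T_sep x y"]) auto
    qed
  next
    case (Refl s A x)
    then show ?thesis by (intro same) (auto simp: refl)
  next
    case (Trans x y z)
    then show ?thesis using S[OF Trans(2)] S[OF Trans(3)] by (intro same) (auto intro: trans)
  next
    case (Persist1 x1 x2 y)
    have "separated M (f x1) (f x2)" using Persist1(2) by (auto simp: separated_def dest!: S)
    then have "separated M (f y) (f x2)" using S[OF Persist1(3)] by (auto intro: persist[OF W W W])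
    then show ?thesis using Persist1(1) by (intro same) (auto simp: separated_def)
  next
    case (Persist2 x1 x2 y)
    \<comment> \<open>Persistence of the frame moves the first component only; separation is
      symmetric, so the pair is swapped first.\<close>
    have "separated M (f x2) (f x1)" using Persist2(2) by (auto simp: separated_def dest!: S)
    then have "separated M (f y) (f x1)" using S[OF Persist2(3)] by (auto intro: persist[OF W W W])
    then show ?thesis using Persist2(1) by (intro same) (auto simp: separated_def)
  qed
qed

section \<open>Existence of branches along an invariant\<close>

primrec subtree_at :: "nat list \<Rightarrow> tree \<Rightarrow> tree" where
  "subtree_at [] t = t"
| "subtree_at (i # p) t = subtree_at p (children t ! i)"

lemma subtree_at_snoc: "subtree_at (p @ [i]) t = children (subtree_at p t) ! i"
  by (induction p arbitrary: t) auto

lemma node_at_conv_subtree: "node_at p t = root (subtree_at p t)"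
  by (induction p arbitrary: t) auto

lemma positions_Nil [simp]: "(t, []) \<in> positions"
  by (rule positions.root)

lemma positions_Cons [simp]:
  "(t, i # p) \<in> positions \<longleftrightarrow> i < length (children t) \<and> (children t ! i, p) \<in> positions"
  by (auto intro: positions.child elim: positions.cases)

lemma positions_append:
  "(t, p @ q) \<in> positions \<longleftrightarrow> (t, p) \<in> positions \<and> (subtree_at p t, q) \<in> positions"
  by (induction p arbitrary: t) auto

text \<open>Starting at the root, keep choosing a child that satisfies \<open>Q\<close>. The
  positions visited form a prefix-closed chain, which is maximal because it stops only at a
  leaf.\<close>

lemma branch_exists:
  assumes Nil: "Q []"
    and step: "\<And>p. \<lbrakk>(t, p) \<in> positions; Q p; children (subtree_at p t) \<noteq> []\<rbrakk>
      \<Longrightarrow> \<exists>i<length (children (subtree_at p t)). Q (p @ [i])"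
  obtains P where "is_branch t P" "\<And>p. p \<in> P \<Longrightarrow> Q p"
proof -
  \<comment> \<open>At a leaf the sequence becomes constant, so a single total sequence covers
    finite and infinite branches alike.\<close>
  define nxt where "nxt p = (if children (subtree_at p t) = [] then p
    else p @ [SOME i. i < length (children (subtree_at p t)) \<and> Q (p @ [i])])" for p
  define g where "g n = (nxt ^^ n) []" for n
  have g_0: "g 0 = []" and g_Suc: "g (Suc n) = nxt (g n)" for n
    by (simp_all add: g_def)
  have good: "(t, g n) \<in> positions \<and> Q (g n)" for n
  proof (induction n)
    case 0
    then show ?case by (simp add: g_0 Nil)
  next
    case (Suc n)
    show ?case
    proof (cases "children (subtree_at (g n) t) = []")
      case True
      then show ?thesis using Suc by (simp add: g_Suc nxt_def)
    next
      case False
      with Suc step have "\<exists>i. i < length (children (subtree_at (g n) t)) \<and> Q (g n @ [i])"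
        by blast
      from someI_ex[OF this] show ?thesis
        using Suc False by (simp add: g_Suc nxt_def positions_append)
    qed
  qed
  have prefix_Suc: "prefix (g n) (g (Suc n))" for n
    by (simp add: g_Suc nxt_def)
  have mono: "prefix (g m) (g n)" if "m \<le> n" for m n
    using that by (induction rule: dec_induct) (auto intro: prefix_order.trans prefix_Suc)
  \<comment> \<open>Each step appends at most one index, so no prefix is skipped.\<close>
  have down: "q \<in> range g" if "prefix q (g n)" for q n
    using that
  proof (induction n)
    case 0
    then show ?case using g_0 by (metis prefix_Nil rangeI)
  next
    case (Suc n)
    show ?case
    proof (cases "q = g (Suc n)")
      case False
      with Suc.prems have "prefix q (g n)"
        by (auto simp: g_Suc nxt_def split: if_splits)
      then show ?thesis by (rule Suc.IH)
    qed simp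
  qed
  \<comment> \<open>A position strictly above all \<open>g n\<close> would mean that no
    \<open>g n\<close> is a leaf. Each step then lengthens the path by one, and the lengths outgrow
    that of \<open>q\<close>.\<close>
  have not_above: False if q: "(t, q) \<in> positions" "q \<notin> range g" and
    above: "\<And>n. prefix (g n) q" for q
  proof -
    have "length (g n) = n" for n
    proof (induction n)
      case (Suc n)
      obtain r where r: "q = g n @ r" using above[of n] by (auto simp: prefix_def)
      with q(2) have "r \<noteq> []" by auto
      with r q(1) have "children (subtree_at (g n) t) \<noteq> []"
        by (cases r) (auto simp: positions_append)
      with Suc show ?case by (simp add: g_Suc nxt_def)
    qed (simp add: g_0)
    then have "Suc (length q) \<le> length q" using above prefix_length_le by metis
    then show False by simp
  qed
  have "is_branch t (range g)"
    unfolding is_branch_def pred_on.maxchain_def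
  proof (intro conjI notI)
    show "pred_on.chain {p. (t, p) \<in> positions} strict_prefix (range g)"
      unfolding pred_on.chain_def
    proof (intro conjI ballI)
      fix x y assume "x \<in> range g" "y \<in> range g"
      then have "prefix x y \<or> prefix y x" using mono by (metis imageE nle_le)
      then show "strict_prefix\<^sup>=\<^sup>= x y \<or> strict_prefix\<^sup>=\<^sup>= y x"
        by (auto simp: strict_prefix_def)
    qed (use good in auto)
  next
    assume "\<exists>S. pred_on.chain {p. (t, p) \<in> positions} strict_prefix S \<and> range g \<subset> S"
    then obtain S q where S: "pred_on.chain {p. (t, p) \<in> positions} strict_prefix S"
      "range g \<subset> S" "q \<in> S" "q \<notin> range g" by blast
    \<comment> \<open>A new member \<open>q\<close> of a larger chain is comparable with each
      \<open>g n\<close>; it cannot lie below one, since \<open>range g\<close> is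
      prefix-closed.\<close>
    have "prefix (g n) q" for n
    proof -
      have "prefix (g n) q \<or> prefix q (g n)"
        using S unfolding pred_on.chain_def strict_prefix_def by blast
      then show ?thesis using down S(4) by blast
    qed
    moreover have "(t, q) \<in> positions" using S unfolding pred_on.chain_def by blast
    ultimately show False using S(4) not_above by blast
  qed
  then show ?thesis using that[of "range g"] good by blast
qed

section \<open>Satisfiability along finite initial paths\<close>

definition path_nodes :: "tree \<Rightarrow> nat list \<Rightarrow> node set" where
  "path_nodes t p = {node_at q t |q. prefix q p}"

lemma path_nodes_Nil [simp]: "path_nodes t [] = {root t}"
  by (auto simp: path_nodes_def)

lemma path_nodes_snoc: "path_nodes t (p @ [i]) = insert (node_at (p @ [i]) t) (path_nodes t p)"
  by (auto simp: path_nodes_def)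

text \<open>The list \<open>\<delta>\<close> is the part of the current rule's segment still ahead of \<open>p\<close>: rules are
  applied to whole branches, so the invariant must also hold in the middle of a segment.\<close>

definition satisfiable_at :: "'w bl_model \<Rightarrow> tree \<Rightarrow> nat list \<Rightarrow> bool" where
  "satisfiable_at M t p \<longleftrightarrow> (\<exists>f \<delta> ts. sat_nodes M f (path_nodes t p \<union> set \<delta>) \<and>
     grown (path_nodes t p \<union> set \<delta>) ts \<and>
     children (subtree_at p t) = (if \<delta> = [] then ts else [stem (hd \<delta>) (tl \<delta>) ts]))"

text \<open>Entering the first node of a pending segment moves it from \<delta> to the path. The
  union is unchanged, so the assignment and the trees below the segment are kept.\<close>

lemma satisfiable_at_snoc:
  assumes sub: "children (subtree_at p t) ! i = stem (hd \<delta>) (tl \<delta>) ts" and "\<delta> \<noteq> []"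
    and "sat_nodes M f (path_nodes t p \<union> set \<delta>)" "grown (path_nodes t p \<union> set \<delta>) ts"
  shows "satisfiable_at M t (p @ [i])"
proof -
  obtain m ms where \<delta>: "\<delta> = m # ms" using \<open>\<delta> \<noteq> []\<close> by (cases \<delta>) auto
  have *: "root (stem m ms ts) = m"
    "children (stem m ms ts) = (if ms = [] then ts else [stem (hd ms) (tl ms) ts])"
    by (cases ms; simp)+
  have "node_at (p @ [i]) t = m"
    using sub * by (simp add: node_at_conv_subtree subtree_at_snoc \<delta>)
  then have "path_nodes t (p @ [i]) \<union> set ms = path_nodes t p \<union> set \<delta>"
    by (auto simp: path_nodes_snoc \<delta>)
  then show ?thesis
    unfolding satisfiable_at_def using assms *
    by (intro exI[of _ f] exI[of _ ms] exI[of _ ts]) (simp add: subtree_at_snoc \<delta>)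
qed

text \<open>Inside a segment there is only one way on, and its nodes are already satisfied. At the
  end of a segment the next rule application offers a satisfiable alternative by
  \<open>tbl_rule_sound\<close>, which becomes the new pending segment.\<close>

lemma satisfiable_at_step:
  assumes frame: "is_bl_frame M" and p: "satisfiable_at M t p"
    and ne: "children (subtree_at p t) \<noteq> []"
  shows "\<exists>i<length (children (subtree_at p t)). satisfiable_at M t (p @ [i])"
proof -
  obtain f \<delta> ts where f: "sat_nodes M f (path_nodes t p \<union> set \<delta>)"
    and g: "grown (path_nodes t p \<union> set \<delta>) ts"
    and c: "children (subtree_at p t) = (if \<delta> = [] then ts else [stem (hd \<delta>) (tl \<delta>) ts])"
    using p unfolding satisfiable_at_def by blast
  show ?thesis
  proof (cases "\<delta> = []")
    case False
    \<comment> \<open>An unfinished segment has exactly one child, of index 0.\<close>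
    then show ?thesis using f g c by (intro exI[of _ 0] conjI satisfiable_at_snoc) auto
  next
    case True
    let ?\<Gamma> = "path_nodes t p"
    from g True have "grown ?\<Gamma> ts" by simp
    then show ?thesis
    proof cases
      case stop
      then show ?thesis using c True ne by simp
    next
      case (extend \<delta>s tss)
      obtain h \<epsilon> where h: "\<epsilon> \<in> set \<delta>s" "sat_nodes M h (?\<Gamma> \<union> set \<epsilon>)"
        using tbl_rule_sound[OF extend(2) frame, of f] f True by auto
      then obtain i where i: "i < length \<delta>s" "\<epsilon> = \<delta>s ! i" by (auto simp: in_set_conv_nth)
      have "satisfiable_at M t (p @ [i])"
      proof (rule satisfiable_at_snoc)
        show "children (subtree_at p t) ! i = stem (hd \<epsilon>) (tl \<epsilon>) (tss ! i)"
          using c True extend i by simp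
        show "\<epsilon> \<noteq> []" using tbl_rule_nonempty[OF extend(2) h(1)] .
        show "sat_nodes M h (?\<Gamma> \<union> set \<epsilon>)" by (rule h(2))
        show "grown (?\<Gamma> \<union> set \<epsilon>) (tss ! i)" using extend i by simp
      qed
      then show ?thesis using c True extend i by auto
    qed
  qed
qed

section \<open>Clashes on a branch and the soundness theorem\<close>

lemma closed_branch_path_nodes:
  assumes "is_branch t P" "closed_nodes (branch_nodes t P)"
  obtains p where "p \<in> P" "closed_nodes (path_nodes t p)"
proof -
  have pair: "\<exists>r\<in>P. {m, n} \<subseteq> path_nodes t r"
    if mn: "m \<in> branch_nodes t P" "n \<in> branch_nodes t P" for m n
  proof -
    obtain p q where pq: "p \<in> P" "q \<in> P" "m = node_at p t" "n = node_at q t"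
      using mn by (auto simp: branch_nodes_def)
    \<comment> \<open>Positions on a branch form a chain, so the path to the longer of the two
      contains both nodes.\<close>
    have "prefix p q \<or> prefix q p"
      using assms(1) pq(1,2)
      unfolding is_branch_def pred_on.maxchain_def pred_on.chain_def strict_prefix_def by auto
    then show ?thesis
      using pq by (auto simp: path_nodes_def)
  qed
  from assms(2) have "\<exists>p\<in>P. closed_nodes (path_nodes t p)"
    unfolding closed_nodes_def by (meson pair insert_subset)
  with that show ?thesis by blast
qed

lemma sat_nodes_not_closed: "sat_nodes M f \<Gamma> \<Longrightarrow> \<not> closed_nodes \<Gamma>"
  unfolding sat_nodes_def closed_nodes_def
  by (metis sat_node.simps sign.distinct(1))

theorem mainTheorem4:
  fixes A :: fm
  assumes "tbl_provable A"
  shows "bl_valid TYPE('w) A"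
  unfolding bl_valid_def
proof (intro allI impI ballI, rule ccontr)
  fix M :: "'w bl_model" and w
  assume M: "is_bl_model M" and w: "w \<in> worlds M" "\<not> sat M w A"
  obtain x t where t: "tableau_for A x t" "closed_tableau t"
    using assms by (auto simp: tbl_provable_def)
  have frame: "is_bl_frame M" using M by (simp add: is_bl_model_def)
  \<comment> \<open>The root carries one formula, so the assignment constantly equal to the refuting
    world works; no segment is pending there.\<close>
  have "satisfiable_at M t []"
    unfolding satisfiable_at_def using t(1) w
    by (intro exI[of _ "\<lambda>_. w"] exI[of _ "[]"] exI[of _ "children t"])
      (auto simp: tableau_for_def sat_nodes_def)
  then obtain P where P: "is_branch t P" "\<And>p. p \<in> P \<Longrightarrow> satisfiable_at M t p"
    using branch_exists[of "satisfiable_at M t" t] satisfiable_at_step[OF frame] by blast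
  then obtain p where p: "p \<in> P" "closed_nodes (path_nodes t p)"
    using t(2) closed_branch_path_nodes unfolding closed_tableau_def by blast
  obtain f where "sat_nodes M f (path_nodes t p)"
    using P(2)[OF p(1)] by (auto simp: satisfiable_at_def sat_nodes_Un)
  with p(2) sat_nodes_not_closed show False by blast
qed

end
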